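(* Let $d$ be a positive integer and let $M\in\mathbb{C}^{d\times d}$ be a positive semi-definite Hermitian matrix with eigenvalues $\lambda_1\ge\cdots\ge\lambda_d$. Let $c\in\mathbb{R}$, $a\in\mathbb{C}^d$, and let $A\in\mathbb{C}^{(d+1)\times(d+1)}$ be the Hermitian matrix $$A=\begin{bmatrix} c & a^*\\ a & M\end{bmatrix}.$$ Assume that $M$ has rank $r$ with $1\le r\le d$, and set $\eta_r=|c-\lambda_r|$. Then $$\lambda_{r+1}(A)\ \ge\ \min(c,\lambda_r)-\frac{2\|a\|_2^2}{\eta_r+\sqrt{\eta_r^2+4\|a\|_2^2}}.$$
   Context: For a Hermitian matrix $B$ of size $m$, its eigenvalues, counted with multiplicity, are denoted $\lambda_1(B)\ge\cdots\ge\lambda_m(B)$; thus $\lambda_{r+1}(A)$ is the $(r+1)$-th largest eigenvalue of $A$, while $\lambda_j$ without argument denotes $\lambda_j(M)$. $\|\cdot\|_2$ is the Euclidean norm, and $a^*$ is the conjugate transpose of $a$. The fraction is understood as $0$ when $\eta_r=0$ and $a=0$ (in all cases it equals $\frac12\left(\sqrt{\eta_r^2+4\|a\|_2^2}-\eta_r\right)$). *)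

theory Defs
  imports
    "Jordan_Normal_Form.Schur_Decomposition"
    "Jordan_Normal_Form.DL_Rank"
    "HOL-Analysis.L2_Norm"
begin

definition hermitian_mat :: "complex mat \<Rightarrow> bool" where
  "hermitian_mat B \<longleftrightarrow> square_mat B \<and> mat_adjoint B = B"

text \<open>
  The order on \<^typ>\<open>complex\<close> makes \<open>0 \<le> z\<close> say that \<open>z\<close> is real and nonnegative;
  \<open>(B *\<^sub>v x) \<bullet>c x\<close> is the quadratic form \<open>x\<^sup>* B x\<close>.
\<close>
definition psd_mat :: "complex mat \<Rightarrow> bool" where
  "psd_mat B \<longleftrightarrow> hermitian_mat B \<and>
     (\<forall>x \<in> carrier_vec (dim_row B). 0 \<le> (B *\<^sub>v x) \<bullet>c x)"

text \<open>
  Eigenvalues of a Hermitian matrix in decreasing order, counted with multiplicity as roots of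
  the characteristic polynomial. These roots are real for Hermitian matrices, so \<^const>\<open>Re\<close> only
  changes the type; no meaning is intended for other matrices.
\<close>
definition eigvals_desc :: "complex mat \<Rightarrow> real list" where
  "eigvals_desc B = rev (sorted_list_of_multiset (image_mset Re (proots (char_poly B))))"

text \<open>The \<open>j\<close>-th largest eigenvalue; \<open>j\<close> ranges over \<open>1, \<dots>, dim_row B\<close>.\<close>
definition eigval :: "complex mat \<Rightarrow> nat \<Rightarrow> real" where
  "eigval B j = eigvals_desc B ! (j - 1)"

definition vec_norm2 :: "complex vec \<Rightarrow> real" where
  "vec_norm2 a = L2_set (\<lambda>i. cmod (a $ i)) {..<dim_vec a}"

definition bordered_mat :: "real \<Rightarrow> complex vec \<Rightarrow> complex mat \<Rightarrow> complex mat" where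
  "bordered_mat c a M =
     (let a_col = mat_of_cols (dim_vec a) [a]
      in four_block_mat (mat 1 1 (\<lambda>_. complex_of_real c)) (mat_adjoint a_col) a_col M)"

end

theory Submission
  imports Defs
begin

text \<open>
  Write \<open>\<lambda>\<^sub>r\<close> for the \<open>r\<close>-th largest eigenvalue of \<open>M\<close> and \<open>\<mu>\<close> for the claimed lower bound. In the
  space of vectors \<open>x = (t, u)\<close> with \<open>t\<close> a scalar, consider the subspace where \<open>u\<close> ranges over the
  span of eigenvectors of \<open>M\<close> for its \<open>r\<close> largest eigenvalues; it has dimension \<open>r + 1\<close>. There
  \<open>u\<^sup>* M u \<ge> \<lambda>\<^sub>r \<parallel>u\<parallel>\<^sup>2\<close>, and with Cauchy--Schwarz for the border terms,
  \<open>x\<^sup>* A x \<ge> c |t|\<^sup>2 - 2 \<parallel>a\<parallel> |t| \<parallel>u\<parallel> + \<lambda>\<^sub>r \<parallel>u\<parallel>\<^sup>2\<close>.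
  The right-hand side is the quadratic form of a real symmetric \<open>2 \<times> 2\<close> matrix with diagonal \<open>c\<close>,
  \<open>\<lambda>\<^sub>r\<close> and off-diagonal entries \<open>- \<parallel>a\<parallel>\<close>, evaluated at \<open>(|t|, \<parallel>u\<parallel>)\<close>. The smaller eigenvalue of
  this matrix is exactly \<open>\<mu>\<close> (\<open>min_eigenvalue_2x2\<close>), so \<open>x\<^sup>* A x \<ge> \<mu> \<parallel>x\<parallel>\<^sup>2\<close> on a subspace of
  dimension \<open>r + 1\<close>. By one half of the Courant--Fischer principle
  (\<open>eigval_lower_bound_on_subspace\<close>), the \<open>(r + 1)\<close>-th largest eigenvalue of \<open>A\<close> is at least \<open>\<mu>\<close>.

  Both the choice of the subspace and the Courant--Fischer argument need an orthonormal
  eigenbasis sorted by decreasing eigenvalue, that is, a spectral theorem in which the order of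
  the eigenvalues can be prescribed (\<open>hermitian_unitarily_diagonalizable\<close>). It is proved by
  splitting off one eigenvector at a time.
\<close>

section \<open>Adjoints, inner products and norms\<close>

lemma mat_adjoint_dim [simp]:
  "dim_row (mat_adjoint A) = dim_col A" "dim_col (mat_adjoint A) = dim_row A"
  by (simp_all add: mat_adjoint_def)

lemma mat_adjoint_carrier [simp]:
  "A \<in> carrier_mat n m \<Longrightarrow> mat_adjoint A \<in> carrier_mat m n"
  by auto

lemma mat_adjoint_index [simp]:
  assumes "i < dim_col A" and "j < dim_row A"
  shows "mat_adjoint A $$ (i, j) = conjugate (A $$ (j, i))"
  using assms by (simp add: mat_adjoint_def mat_of_rows_index)

lemma mat_adjoint_adjoint [simp]:
  fixes A :: "complex mat"
  shows "mat_adjoint (mat_adjoint A) = A"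
  by (intro eq_matI) auto

lemma mat_adjoint_mult:
  fixes A B :: "complex mat"
  assumes "A \<in> carrier_mat n m" and "B \<in> carrier_mat m k"
  shows "mat_adjoint (A * B) = mat_adjoint B * mat_adjoint A"
  using assms by (intro eq_matI) (auto simp: scalar_prod_def intro!: sum.cong)

lemma mat_adjoint_four_block:
  fixes A B C D :: "complex mat"
  assumes "A \<in> carrier_mat n1 m1" "B \<in> carrier_mat n1 m2" "C \<in> carrier_mat n2 m1" "D \<in> carrier_mat n2 m2"
  shows "mat_adjoint (four_block_mat A B C D) =
    four_block_mat (mat_adjoint A) (mat_adjoint C) (mat_adjoint B) (mat_adjoint D)"
  using assms by (intro eq_matI) auto

lemma mat_adjoint_zero [simp]: "mat_adjoint (0\<^sub>m n m :: complex mat) = 0\<^sub>m m n"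
  by (intro eq_matI) auto

lemma mat_adjoint_one [simp]: "mat_adjoint (1\<^sub>m n :: complex mat) = 1\<^sub>m n"
  by (intro eq_matI) auto

lemma cscalar_prod_adjoint:
  fixes A :: "complex mat"
  assumes A: "A \<in> carrier_mat n m" and x: "x \<in> carrier_vec m" and y: "y \<in> carrier_vec n"
  shows "(A *\<^sub>v x) \<bullet>c y = x \<bullet>c (mat_adjoint A *\<^sub>v y)"
proof -
  have "(A *\<^sub>v x) \<bullet>c y = (\<Sum>i<n. \<Sum>j<m. A $$ (i,j) * x $ j * cnj (y $ i))"
    using assms by (auto simp: scalar_prod_def sum_distrib_right atLeast0LessThan intro!: sum.cong)
  also have "\<dots> = (\<Sum>j<m. \<Sum>i<n. A $$ (i,j) * x $ j * cnj (y $ i))"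
    by (rule sum.swap)
  also have "\<dots> = x \<bullet>c (mat_adjoint A *\<^sub>v y)"
    using assms by (auto simp: scalar_prod_def sum_distrib_left atLeast0LessThan mult_ac intro!: sum.cong)
  finally show ?thesis .
qed

lemma vec_norm2_sq: "(vec_norm2 x)\<^sup>2 = (\<Sum>i<dim_vec x. (cmod (x $ i))\<^sup>2)"
  by (simp add: vec_norm2_def L2_set_def sum_nonneg)

lemma vec_norm2_nonneg [simp]: "0 \<le> vec_norm2 x"
  by (simp add: vec_norm2_def)

lemma cscalar_prod_self: "x \<bullet>c x = complex_of_real ((vec_norm2 x)\<^sup>2)"
  by (simp add: vec_norm2_sq scalar_prod_def atLeast0LessThan complex_norm_square
      of_real_power[symmetric] del: of_real_power)

lemma vec_norm2_eq_0_iff: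
  assumes "x \<in> carrier_vec n"
  shows "vec_norm2 x = 0 \<longleftrightarrow> x = 0\<^sub>v n"
proof -
  have "vec_norm2 x = 0 \<longleftrightarrow> x \<bullet>c x = 0"
    by (simp add: cscalar_prod_self)
  then show ?thesis
    using conjugate_square_eq_0_vec[OF assms] by simp
qed

lemma cscalar_prod_Cauchy_Schwarz:
  assumes "dim_vec x = dim_vec y"
  shows "cmod (x \<bullet>c y) \<le> vec_norm2 x * vec_norm2 y"
proof -
  have "cmod (x \<bullet>c y) \<le> (\<Sum>i<dim_vec x. cmod (x $ i) * cmod (y $ i))"
    using assms
    by (auto simp: scalar_prod_def atLeast0LessThan norm_mult intro!: order_trans[OF norm_sum])
  also have "\<dots> \<le> vec_norm2 x * vec_norm2 y"
    using L2_set_mult_ineq[of "\<lambda>i. cmod (x $ i)" "\<lambda>i. cmod (y $ i)" "{..<dim_vec x}"] assms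
    by (simp add: vec_norm2_def)
  finally show ?thesis .
qed

lemma mult_block_diag:
  fixes A B C D :: "complex mat"
  assumes "A \<in> carrier_mat k1 k2" "B \<in> carrier_mat m1 m2" "C \<in> carrier_mat k2 k3" "D \<in> carrier_mat m2 m3"
  shows "four_block_mat A (0\<^sub>m k1 m2) (0\<^sub>m m1 k2) B * four_block_mat C (0\<^sub>m k2 m3) (0\<^sub>m m2 k3) D =
    four_block_mat (A * C) (0\<^sub>m k1 m3) (0\<^sub>m m1 k3) (B * D)"
  using assms mult_carrier_mat[OF assms(1,3)] mult_carrier_mat[OF assms(2,4)]
  by (subst mult_four_block_mat[of _ k1 k2 _ m2 _ m1 _ _ k3 _ m3]) simp_all

text \<open>
  Two successive changes of basis amount to one, which is what lets the spectral theorem be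
  proved one eigenvector at a time.
\<close>

lemma mat_adjoint_congruence_mult:
  fixes A W V :: "complex mat"
  assumes A: "A \<in> carrier_mat n n" and W: "W \<in> carrier_mat n n" and V: "V \<in> carrier_mat n n"
  shows "mat_adjoint (W * V) * A * (W * V) = mat_adjoint V * (mat_adjoint W * A * W) * V"
proof -
  have c: "mat_adjoint V \<in> carrier_mat n n" "mat_adjoint W \<in> carrier_mat n n"
    using V W by simp_all
  show ?thesis
    using A W V c
    by (simp add: mat_adjoint_mult[OF W V] assoc_mult_mat[of _ n n _ n _ n]
        mult_carrier_mat[of _ n n _ n])
qed

lemma isometry_preserves_vec_norm2:
  assumes U: "U \<in> carrier_mat n m" "mat_adjoint U * U = 1\<^sub>m m" and y: "y \<in> carrier_vec m"
  shows "vec_norm2 (U *\<^sub>v y) = vec_norm2 y"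
proof -
  have "(U *\<^sub>v y) \<bullet>c (U *\<^sub>v y) = y \<bullet>c (mat_adjoint U *\<^sub>v (U *\<^sub>v y))"
    using U y by (intro cscalar_prod_adjoint) auto
  also have "mat_adjoint U *\<^sub>v (U *\<^sub>v y) = y"
    using assoc_mult_mat_vec[OF mat_adjoint_carrier[OF U(1)] U(1) y] U(2) y by simp
  finally have "(vec_norm2 (U *\<^sub>v y))\<^sup>2 = (vec_norm2 y)\<^sup>2"
    by (simp add: cscalar_prod_self flip: of_real_power)
  then show ?thesis
    by simp
qed

section \<open>The spectral theorem for Hermitian matrices\<close>

text \<open>
  Complete \<open>v\<close> to a basis, orthogonalise by Gram--Schmidt, which keeps the first vector, and
  divide every vector by its norm. The normalisation makes \<open>W\<^sup>*\<close>, rather than some other matrix,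
  the inverse of \<open>W\<close>, so that the change of basis preserves Hermitian matrices.
\<close>

lemma unit_vector_extends_to_unitary:
  assumes v: "v \<in> carrier_vec n" and v1: "vec_norm2 v = 1"
  obtains W where "W \<in> carrier_mat n n" "mat_adjoint W * W = 1\<^sub>m n" "col W 0 = v"
proof -
  interpret cof_vec_space n "TYPE(complex)" .
  have v0: "v \<noteq> 0\<^sub>v n"
    using v1 vec_norm2_eq_0_iff[OF v] by auto
  note bc = basis_completion[OF v v0]
  define ws where "ws = gram_schmidt n (basis_completion v)"
  have ws: "set ws \<subseteq> carrier_vec n" "corthogonal ws" "length ws = n"
    using gram_schmidt_result[OF bc(2,4,5) ws_def] bc(6) by auto
  have n0: "n > 0"
    using v v0 by (cases n) auto
  have hd: "ws ! 0 = v"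
  proof -
    obtain vs where "basis_completion v = v # vs"
      using bc(6,7) n0 by (cases "basis_completion v") auto
    then have "hd ws = v"
      unfolding ws_def using gram_schmidt_hd[OF v] by simp
    then show ?thesis
      using ws(3) n0 by (simp add: hd_conv_nth[symmetric] flip: length_greater_0_conv)
  qed
  define us where "us = map (\<lambda>w. complex_of_real (1 / vec_norm2 w) \<cdot>\<^sub>v w) ws"
  define W where "W = mat_of_cols n us"
  have wc: "ws ! i \<in> carrier_vec n" if "i < n" for i
    using ws that by auto
  have W: "W \<in> carrier_mat n n"
    using mat_of_cols_carrier(1)[of n us] ws(3) by (simp add: W_def us_def)
  have col: "col W i = complex_of_real (1 / vec_norm2 (ws ! i)) \<cdot>\<^sub>v ws ! i" if "i < n" for i
    using that ws wc[OF that] by (simp add: W_def us_def)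
  have "mat_adjoint W * W = 1\<^sub>m n"
  proof (rule eq_matI)
    fix i j assume ij: "i < dim_row (1\<^sub>m n :: complex mat)" "j < dim_col (1\<^sub>m n :: complex mat)"
    then have i: "i < n" and j: "j < n" by auto
    have "(mat_adjoint W * W) $$ (i, j) = col W j \<bullet>c col W i"
      using i j W by (auto simp: scalar_prod_def intro!: sum.cong)
    also have "\<dots> = complex_of_real (1 / (vec_norm2 (ws ! i) * vec_norm2 (ws ! j))) * (ws ! j \<bullet>c ws ! i)"
      using i j wc[OF i] wc[OF j] by (simp add: col conjugate_smult_vec)
    also have "\<dots> = 1\<^sub>m n $$ (i, j)"
    proof (cases "i = j")
      case True
      have "vec_norm2 (ws ! i) \<noteq> 0"
        using corthogonalD[OF ws(2), of i i] i ws(3) by (auto simp: cscalar_prod_self)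
      then show ?thesis
        using True i by (simp add: cscalar_prod_self power2_eq_square)
    next
      case False
      then show ?thesis
        using corthogonalD[OF ws(2), of j i] i j ws(3) by auto
    qed
    finally show "(mat_adjoint W * W) $$ (i, j) = 1\<^sub>m n $$ (i, j)" .
  qed (use W in auto)
  moreover have "col W 0 = v"
    using col[OF n0] hd v1 by simp
  ultimately show thesis
    using that W by blast
qed

text \<open>
  In an orthonormal basis starting with an eigenvector, the first column of the matrix is
  \<open>e\<close> followed by zeros. Being Hermitian, the matrix then has zeros in its first row as well
  (and \<open>e\<close> is real), so it splits into two blocks and the remaining block is again Hermitian.
\<close>

lemma hermitian_deflation:
  fixes A :: "complex mat"
  assumes A: "A \<in> carrier_mat (Suc m) (Suc m)" and h: "mat_adjoint A = A"
    and e: "eigenvalue A e"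
  obtains W A3 where "W \<in> carrier_mat (Suc m) (Suc m)" "mat_adjoint W * W = 1\<^sub>m (Suc m)"
    "A3 \<in> carrier_mat m m" "mat_adjoint A3 = A3"
    "mat_adjoint W * A * W = four_block_mat (mat 1 1 (\<lambda>_. e)) (0\<^sub>m 1 m) (0\<^sub>m m 1) A3"
proof -
  obtain u where u: "u \<in> carrier_vec (Suc m)" "u \<noteq> 0\<^sub>v (Suc m)" "A *\<^sub>v u = e \<cdot>\<^sub>v u"
    using e A by (auto simp: eigenvalue_def eigenvector_def)
  define v where "v = complex_of_real (1 / vec_norm2 u) \<cdot>\<^sub>v u"
  have v: "v \<in> carrier_vec (Suc m)" using u by (simp add: v_def)
  have "vec_norm2 u \<noteq> 0" using u vec_norm2_eq_0_iff by blast
  then have "v \<bullet>c v = 1"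
    using u by (simp add: v_def conjugate_smult_vec cscalar_prod_self power2_eq_square)
  then have "(vec_norm2 v)\<^sup>2 = 1"
    by (simp add: cscalar_prod_self flip: of_real_power)
  then have v1: "vec_norm2 v = 1"
    by (simp add: power2_eq_1_iff) (use vec_norm2_nonneg[of v] in linarith)
  have Av: "A *\<^sub>v v = e \<cdot>\<^sub>v v"
    using u A by (simp add: v_def mult_mat_vec smult_smult_assoc mult.commute)
  obtain W where W: "W \<in> carrier_mat (Suc m) (Suc m)" "mat_adjoint W * W = 1\<^sub>m (Suc m)" "col W 0 = v"
    using unit_vector_extends_to_unitary[OF v v1] .
  let ?W = "mat_adjoint W"
  have W': "?W \<in> carrier_mat (Suc m) (Suc m)" using W by simp
  define A' where "A' = ?W * A * W"
  have A': "A' \<in> carrier_mat (Suc m) (Suc m)" using A W W' by (metis A'_def mult_carrier_mat)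
  have h': "mat_adjoint A' = A'"
    using A W W' h
    by (simp add: A'_def mat_adjoint_mult[of _ "Suc m" "Suc m" _ "Suc m"]
        assoc_mult_mat[of _ "Suc m" "Suc m" _ "Suc m" _ "Suc m"])
  have "col A' 0 = ?W *\<^sub>v (A *\<^sub>v v)"
    using A W W' v col_mult2[OF mult_carrier_mat[OF W' A] W(1), of 0]
      assoc_mult_mat_vec[OF W' A v] by (simp add: A'_def)
  also have "\<dots> = e \<cdot>\<^sub>v (?W *\<^sub>v col W 0)"
    using W v mult_mat_vec[OF W' v] by (simp add: Av)
  also have "?W *\<^sub>v col W 0 = col (?W * W) 0"
    using col_mult2[OF W' W(1), of 0] by simp
  finally have col0: "col A' 0 = e \<cdot>\<^sub>v col (1\<^sub>m (Suc m)) 0"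
    unfolding W(2) .
  have c0: "A' $$ (i, 0) = (if i = 0 then e else 0)" if "i < Suc m" for i
    using arg_cong[OF col0, of "\<lambda>x. x $ i"] that A' by auto
  have r0: "A' $$ (0, i) = (if i = 0 then e else 0)" if "i < Suc m" for i
  proof (cases "i = 0")
    case False
    have "A' $$ (0, i) = mat_adjoint A' $$ (0, i)" by (simp add: h')
    also have "\<dots> = cnj (A' $$ (i, 0))" using A' that by simp
    finally show ?thesis using False c0[OF that] by simp
  qed (use c0 in auto)
  define A3 where "A3 = mat m m (\<lambda>(i, j). A' $$ (Suc i, Suc j))"
  have A3_carrier: "A3 \<in> carrier_mat m m" by (simp add: A3_def)
  have "mat_adjoint A3 = A3"
  proof (rule eq_matI)
    fix i j assume ij: "i < dim_row A3" "j < dim_col A3"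
    have "A3 $$ (i, j) = mat_adjoint A' $$ (Suc i, Suc j)"
      using ij by (simp add: h' A3_def)
    also have "\<dots> = mat_adjoint A3 $$ (i, j)"
      using ij A' by (simp add: A3_def)
    finally show "mat_adjoint A3 $$ (i, j) = A3 $$ (i, j)" by simp
  qed (auto simp: A3_def)
  moreover have "A' = four_block_mat (mat 1 1 (\<lambda>_. e)) (0\<^sub>m 1 m) (0\<^sub>m m 1) A3"
    using A' by (intro eq_matI) (auto simp: A3_def c0 r0)
  ultimately show thesis
    using that[OF W(1,2), of A3] unfolding A'_def[symmetric] by (simp add: A3_carrier)
qed

text \<open>
  The spectral theorem, by repeated deflation. The list \<open>es\<close> prescribes the order in which the
  roots of the characteristic polynomial appear on the diagonal: deflation can start with any
  root, and the characteristic polynomial of the remaining block is the old one divided by the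
  corresponding linear factor. Control over this order is what later gives a basis sorted by
  decreasing eigenvalue.
\<close>

lemma hermitian_unitarily_diagonalizable:
  fixes A :: "complex mat"
  assumes "A \<in> carrier_mat n n" and "mat_adjoint A = A"
    and "char_poly A = (\<Prod>e\<leftarrow>es. [:- e, 1:])"
  shows "\<exists>U \<in> carrier_mat n n. mat_adjoint U * U = 1\<^sub>m n \<and>
    mat_adjoint U * A * U = mat_diag n (\<lambda>i. es ! i)"
  using assms
proof (induction es arbitrary: n A)
  case Nil
  then have "n = 0"
    using degree_monic_char_poly[OF Nil(1)] by simp
  then show ?case
    using Nil by (intro bexI[of _ "1\<^sub>m 0"] conjI eq_matI) (auto simp: mat_diag_def)
next
  case (Cons e es)
  note A = Cons.prems(1)
  have "degree (char_poly A) > 0"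
  proof -
    have "(\<Prod>e\<leftarrow>es. [:- e, 1:]) \<noteq> (0 :: complex poly)"
      by (auto simp: prod_list_zero_iff)
    then show ?thesis
      by (simp add: Cons.prems(3) degree_mult_eq del: mult_pCons_left)
  qed
  then obtain m where n: "n = Suc m"
    using degree_monic_char_poly[OF A] by (cases n) auto
  have ev: "eigenvalue A e"
    using eigenvalue_root_char_poly[OF A] Cons.prems(3) by simp
  obtain W A3 where W: "W \<in> carrier_mat n n" "mat_adjoint W * W = 1\<^sub>m n"
    and A3: "A3 \<in> carrier_mat m m" "mat_adjoint A3 = A3"
    and WAW: "mat_adjoint W * A * W = four_block_mat (mat 1 1 (\<lambda>_. e)) (0\<^sub>m 1 m) (0\<^sub>m m 1) A3"
    using hermitian_deflation[of A m e] A Cons.prems(2) ev unfolding n by metis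
  let ?e = "mat 1 1 (\<lambda>_. e)"
  let ?A' = "mat_adjoint W * A * W"
  have WW: "W * mat_adjoint W = 1\<^sub>m n"
    using mat_mult_left_right_inverse[OF _ W(1) W(2)] W(1) by simp
  have "similar_mat_wit ?A' A (mat_adjoint W) W"
    using W WW A by (intro similar_mat_witI[of _ _ n]) auto
  then have "char_poly ?A' = char_poly A"
    by (intro char_poly_similar) (auto simp: similar_mat_def)
  moreover have "char_poly ?A' = char_poly ?e * char_poly A3"
    unfolding WAW using A3 by (intro char_poly_four_block_zeros_col) auto
  moreover have "char_poly ?e = [:- e, 1:]"
    by (simp add: char_poly_defs det_def sign_def)
  ultimately have "[:- e, 1:] * char_poly A3 = [:- e, 1:] * (\<Prod>e\<leftarrow>es. [:- e, 1:])"
    using Cons.prems(3) by simp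
  then have "char_poly A3 = (\<Prod>e\<leftarrow>es. [:- e, 1:])"
    by (metis mult_cancel_left pCons_eq_0_iff zero_neq_one)
  from Cons.IH[OF A3 this] obtain V where V: "V \<in> carrier_mat m m" "mat_adjoint V * V = 1\<^sub>m m"
    and VAV: "mat_adjoint V * A3 * V = mat_diag m (\<lambda>i. es ! i)"
    by blast
  let ?V = "four_block_mat (1\<^sub>m 1) (0\<^sub>m 1 m) (0\<^sub>m m 1) V"
  have V': "?V \<in> carrier_mat n n" using V n by auto
  have adjV: "mat_adjoint ?V = four_block_mat (1\<^sub>m 1) (0\<^sub>m 1 m) (0\<^sub>m m 1) (mat_adjoint V)"
    using V by (simp add: mat_adjoint_four_block[of _ 1 1 _ m _ m])
  have VV: "mat_adjoint ?V * ?V = 1\<^sub>m n"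
    unfolding adjV n using V by (subst mult_block_diag) auto
  have VAV': "mat_adjoint ?V * ?A' * ?V = mat_diag n (\<lambda>i. (e # es) ! i)"
  proof -
    have "mat_adjoint ?V * ?A' * ?V = four_block_mat ?e (0\<^sub>m 1 m) (0\<^sub>m m 1) (mat_adjoint V * A3 * V)"
    proof -
      have c: "mat_adjoint V \<in> carrier_mat m m" using V by simp
      have e: "?e \<in> carrier_mat 1 1" by simp
      show ?thesis
        unfolding adjV WAW mult_block_diag[OF one_carrier_mat c e A3(1)]
          left_mult_one_mat[OF e] mult_block_diag[OF e mult_carrier_mat[OF c A3(1)] one_carrier_mat V(1)]
          right_mult_one_mat[OF e] ..
    qed
    also have "\<dots> = mat_diag n (\<lambda>i. (e # es) ! i)"
      unfolding VAV n by (intro eq_matI) (auto simp: mat_diag_def nth_Cons')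
    finally show ?thesis .
  qed
  show ?case
  proof (intro bexI conjI)
    show U: "W * ?V \<in> carrier_mat n n" using W V' by simp
    show "mat_adjoint (W * ?V) * (W * ?V) = 1\<^sub>m n"
      using mat_adjoint_congruence_mult[OF one_carrier_mat W(1) V'] W VV
        right_mult_one_mat[OF mat_adjoint_carrier[OF W(1)]]
        right_mult_one_mat[OF mat_adjoint_carrier[OF V']] by simp
    show "mat_adjoint (W * ?V) * A * (W * ?V) = mat_diag n (\<lambda>i. (e # es) ! i)"
      using mat_adjoint_congruence_mult[OF A W(1) V'] VAV' by simp
  qed
qed

lemma proots_linear_factors:
  fixes es :: "'a :: idom list"
  shows "proots (\<Prod>e\<leftarrow>es. [:- e, 1:]) = mset es"
proof (induction es)
  case (Cons e es)
  have "(\<Prod>e\<leftarrow>es. [:- e, 1:]) \<noteq> 0"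
    by (auto simp: prod_list_zero_iff)
  then show ?case
    using Cons by (simp add: proots_mult del: mult_pCons_left)
qed simp

text \<open>
  The roots are the diagonal entries of a matrix \<open>U\<^sup>* A U\<close>, which is Hermitian like \<open>A\<close>; diagonal
  entries of Hermitian matrices equal their own conjugates.
\<close>

lemma hermitian_char_poly_roots_real:
  fixes A :: "complex mat"
  assumes A: "A \<in> carrier_mat n n" and h: "mat_adjoint A = A"
    and cp: "char_poly A = (\<Prod>e\<leftarrow>es. [:- e, 1:])" and e: "e \<in> set es"
  shows "complex_of_real (Re e) = e"
proof -
  obtain U where U: "U \<in> carrier_mat n n"
    and D: "mat_adjoint U * A * U = mat_diag n (\<lambda>i. es ! i)"
    using hermitian_unitarily_diagonalizable[OF A h cp] by blast
  have U': "mat_adjoint U \<in> carrier_mat n n" using U by simp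
  have "mat_adjoint (mat_adjoint U * A * U) = mat_adjoint U * A * U"
    using A U U' h
    by (simp add: mat_adjoint_mult[of _ n n _ n] mult_carrier_mat[of _ n n _ n]
        assoc_mult_mat[of _ n n _ n _ n])
  then have h': "mat_adjoint (mat_diag n (\<lambda>i. es ! i)) = mat_diag n (\<lambda>i. es ! i)"
    by (simp add: D)
  have len: "length es = n"
    using degree_linear_factors[of uminus es] degree_monic_char_poly[OF A] cp by simp
  obtain i where i: "i < n" "e = es ! i"
    using e len by (auto simp: in_set_conv_nth)
  have "cnj e = mat_adjoint (mat_diag n (\<lambda>i. es ! i)) $$ (i, i)"
    using i by (simp add: mat_diag_def)
  also have "\<dots> = e"
    unfolding h' using i by (simp add: mat_diag_def)
  finally show ?thesis
    by (simp add: complex_eq_iff)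
qed

text \<open>
  As the roots are real, \<^const>\<open>eigvals_desc\<close> loses nothing by taking real parts: embedded back into
  the complex numbers, it is a list of all roots with multiplicity, and hence an admissible order
  of the diagonal entries in the spectral theorem.
\<close>

lemma hermitian_eigval_decomposition:
  fixes A :: "complex mat"
  assumes A: "A \<in> carrier_mat n n" and h: "mat_adjoint A = A"
  shows "length (eigvals_desc A) = n"
    and "\<exists>U \<in> carrier_mat n n. mat_adjoint U * U = 1\<^sub>m n \<and>
      mat_adjoint U * A * U = mat_diag n (\<lambda>i. complex_of_real (eigval A (Suc i)))"
proof -
  obtain es where cp: "char_poly A = (\<Prod>e\<leftarrow>es. [:- e, 1:])" and len: "length es = n"
    using char_poly_factorized[OF A] by blast
  have pr: "proots (char_poly A) = mset es"
    by (simp add: cp proots_linear_factors)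
  define fs where "fs = map complex_of_real (eigvals_desc A)"
  show len': "length (eigvals_desc A) = n"
    by (simp add: eigvals_desc_def pr len flip: size_mset) (simp add: len)
  have "mset fs = image_mset (\<lambda>e. complex_of_real (Re e)) (mset es)"
    by (simp add: fs_def eigvals_desc_def pr multiset.map_comp comp_def)
  also have "\<dots> = image_mset (\<lambda>e. e) (mset es)"
    using hermitian_char_poly_roots_real[OF A h cp] by (intro image_mset_cong) simp
  finally have "mset fs = mset es"
    by simp
  then have "(\<Prod>e\<leftarrow>fs. [:- e, 1:]) = (\<Prod>e\<leftarrow>es. [:- e, 1:])"
    by (metis mset_map prod_mset_prod_list)
  then obtain U where U: "U \<in> carrier_mat n n" "mat_adjoint U * U = 1\<^sub>m n"
    and D: "mat_adjoint U * A * U = mat_diag n (\<lambda>i. fs ! i)"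
    using hermitian_unitarily_diagonalizable[OF A h, of fs] cp by auto
  have "mat_diag n (\<lambda>i. fs ! i) = mat_diag n (\<lambda>i. complex_of_real (eigval A (Suc i)))"
    using len' by (intro eq_matI) (auto simp: mat_diag_def fs_def eigval_def)
  then show "\<exists>U \<in> carrier_mat n n. mat_adjoint U * U = 1\<^sub>m n \<and>
      mat_adjoint U * A * U = mat_diag n (\<lambda>i. complex_of_real (eigval A (Suc i)))"
    using U D by auto
qed

lemma eigval_antimono:
  assumes "i \<le> j" and "j < length (eigvals_desc A)"
  shows "eigval A (Suc j) \<le> eigval A (Suc i)"
  using assms sorted_rev_nth_mono[of "eigvals_desc A" i j]
  by (simp add: eigval_def) (simp add: eigvals_desc_def)

section \<open>Quadratic forms and the order of eigenvalues\<close>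

lemma quadratic_form_in_eigenbasis:
  assumes A: "A \<in> carrier_mat n n" and U: "U \<in> carrier_mat n n"
    and D: "mat_adjoint U * A * U = mat_diag n (\<lambda>i. complex_of_real (f i))"
    and y: "y \<in> carrier_vec n"
  shows "Re ((A *\<^sub>v (U *\<^sub>v y)) \<bullet>c (U *\<^sub>v y)) = (\<Sum>i<n. f i * (cmod (y $ i))\<^sup>2)"
proof -
  have U': "mat_adjoint U \<in> carrier_mat n n" using U by simp
  have Uy: "U *\<^sub>v y \<in> carrier_vec n" using U y by simp
  have AUy: "A *\<^sub>v (U *\<^sub>v y) \<in> carrier_vec n" using A Uy by simp
  have "(A *\<^sub>v (U *\<^sub>v y)) \<bullet>c (U *\<^sub>v y) = (mat_adjoint U *\<^sub>v (A *\<^sub>v (U *\<^sub>v y))) \<bullet>c y"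
    using cscalar_prod_adjoint[OF U' AUy y] by simp
  also have "mat_adjoint U *\<^sub>v (A *\<^sub>v (U *\<^sub>v y)) = (mat_adjoint U * A * U) *\<^sub>v y"
    using A U U' y Uy by (simp add: assoc_mult_mat_vec[of _ n n _ n] mult_carrier_mat[of _ n n _ n])
  also have "\<dots> = vec n (\<lambda>i. complex_of_real (f i) * y $ i)"
    unfolding D using y
    by (intro eq_vecI) (auto simp: mat_diag_def scalar_prod_def if_distrib if_distribR sum.delta cong: if_cong)
  also have "\<dots> \<bullet>c y = (\<Sum>i<n. complex_of_real (f i * (cmod (y $ i))\<^sup>2))"
    using y by (auto simp: scalar_prod_def atLeast0LessThan complex_norm_square mult.assoc
        simp del: of_real_power intro!: sum.cong)
  finally show ?thesis
    by simp
qed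

text \<open>
  One half of the Courant--Fischer max-min principle; the subspace of dimension \<open>k\<close> is the range
  of the injective map \<open>F\<close>. The eigenvectors belonging to \<open>\<lambda>\<^sub>k, \<dots>, \<lambda>\<^sub>n\<close> span a subspace of
  codimension \<open>k - 1\<close>, on which the quadratic form is at most \<open>\<lambda>\<^sub>k \<parallel>x\<parallel>\<^sup>2\<close>. Two subspaces whose
  dimensions add up to \<open>n + 1\<close> share a nonzero vector, and comparing both bounds at such a vector
  gives \<open>\<mu> \<le> \<lambda>\<^sub>k\<close>.
\<close>

lemma eigval_lower_bound_on_subspace:
  fixes A F :: "complex mat"
  assumes A: "A \<in> carrier_mat n n" and h: "mat_adjoint A = A"
    and F: "F \<in> carrier_mat n k" and k: "1 \<le> k" "k \<le> n"
    and inj: "\<And>z. z \<in> carrier_vec k \<Longrightarrow> F *\<^sub>v z = 0\<^sub>v n \<Longrightarrow> z = 0\<^sub>v k"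
    and lb: "\<And>z. z \<in> carrier_vec k \<Longrightarrow>
      \<mu> * (vec_norm2 (F *\<^sub>v z))\<^sup>2 \<le> Re ((A *\<^sub>v (F *\<^sub>v z)) \<bullet>c (F *\<^sub>v z))"
  shows "\<mu> \<le> eigval A k"
proof -
  note dec = hermitian_eigval_decomposition[OF A h]
  obtain U where U: "U \<in> carrier_mat n n" "mat_adjoint U * U = 1\<^sub>m n"
    and D: "mat_adjoint U * A * U = mat_diag n (\<lambda>i. complex_of_real (eigval A (Suc i)))"
    using dec(2) by blast
  have U': "mat_adjoint U \<in> carrier_mat n n" using U by simp
  have UU': "U * mat_adjoint U = 1\<^sub>m n"
    using mat_mult_left_right_inverse[OF U' U(1) U(2)] .
  \<comment> \<open>The common vector solves \<open>k - 1\<close> equations in \<open>k\<close> unknowns: the first \<open>k - 1\<close> coordinates of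
    \<open>F z\<close> in the eigenbasis vanish. Padding the system with a zero row makes it square and
    singular.\<close>
  let ?row = "\<lambda>i. row (mat_adjoint U * F) i"
  define G where "G = mat\<^sub>r k k (\<lambda>i. if i = k - 1 then 0\<^sub>v k else ?row i)"
  have G: "G \<in> carrier_mat k k" by (simp add: G_def)
  have "det G = 0"
    unfolding G_def using k row_carrier[of "mat_adjoint U * F"] F by (intro det_row_0) auto
  then obtain z where z: "z \<in> carrier_vec k" "z \<noteq> 0\<^sub>v k" "G *\<^sub>v z = 0\<^sub>v k"
    using det_0_iff_vec_prod_zero_field[OF G] by blast
  define x where "x = F *\<^sub>v z"
  define y where "y = mat_adjoint U *\<^sub>v x"
  have x: "x \<in> carrier_vec n" using F z by (simp add: x_def)
  have y: "y \<in> carrier_vec n" using U' x by (simp add: y_def)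
  have Uy: "U *\<^sub>v y = x"
    using assoc_mult_mat_vec[OF U(1) U' x] UU' x by (simp add: y_def)
  have y0: "y $ i = 0" if "i < k - 1" for i
  proof -
    have "y = (mat_adjoint U * F) *\<^sub>v z"
      using assoc_mult_mat_vec[OF U' F z(1)] by (simp add: y_def x_def)
    then have "y $ i = (G *\<^sub>v z) $ i"
      using that k F U(1) z(1) row_carrier[of "mat_adjoint U * F" i] by (simp add: G_def)
    then show ?thesis using that z by simp
  qed
  have norm: "vec_norm2 y = vec_norm2 x"
    using isometry_preserves_vec_norm2[OF U y] Uy by simp
  have "\<mu> * (vec_norm2 x)\<^sup>2 \<le> Re ((A *\<^sub>v x) \<bullet>c x)"
    using lb[OF z(1)] by (simp add: x_def)
  also have "\<dots> = (\<Sum>i<n. eigval A (Suc i) * (cmod (y $ i))\<^sup>2)"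
    using quadratic_form_in_eigenbasis[OF A U(1) D y] Uy by simp
  also have "\<dots> \<le> (\<Sum>i<n. eigval A k * (cmod (y $ i))\<^sup>2)"
  proof (rule sum_mono)
    fix i assume i: "i \<in> {..<n}"
    show "eigval A (Suc i) * (cmod (y $ i))\<^sup>2 \<le> eigval A k * (cmod (y $ i))\<^sup>2"
    proof (cases "i < k - 1")
      case False
      then have "eigval A (Suc i) \<le> eigval A (Suc (k - 1))"
        using i dec(1) by (intro eigval_antimono) auto
      then show ?thesis
        using k by (intro mult_right_mono) auto
    qed (simp add: y0)
  qed
  also have "\<dots> = eigval A k * (vec_norm2 x)\<^sup>2"
    using y by (simp add: sum_distrib_left vec_norm2_sq flip: norm)
  finally have "\<mu> * (vec_norm2 x)\<^sup>2 \<le> eigval A k * (vec_norm2 x)\<^sup>2" .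
  moreover have "vec_norm2 x \<noteq> 0"
    using inj[OF z(1)] z(2) vec_norm2_eq_0_iff[OF x] by (auto simp: x_def)
  ultimately show ?thesis
    by simp
qed

text \<open>
  The complementary fact: on the span of the eigenvectors belonging to \<open>\<lambda>\<^sub>1, \<dots>, \<lambda>\<^sub>r\<close>, here the range
  of the matrix \<open>F\<close> with these vectors as columns, the quadratic form is at least \<open>\<lambda>\<^sub>r \<parallel>x\<parallel>\<^sup>2\<close>.
\<close>

lemma top_eigenvectors_isometry:
  fixes M :: "complex mat"
  assumes M: "M \<in> carrier_mat d d" and h: "mat_adjoint M = M" and r: "1 \<le> r" "r \<le> d"
  obtains F where "F \<in> carrier_mat d r" "mat_adjoint F * F = 1\<^sub>m r"
    "\<And>y. y \<in> carrier_vec r \<Longrightarrow>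
      eigval M r * (vec_norm2 (F *\<^sub>v y))\<^sup>2 \<le> Re ((M *\<^sub>v (F *\<^sub>v y)) \<bullet>c (F *\<^sub>v y))"
proof -
  note dec = hermitian_eigval_decomposition[OF M h]
  obtain U where U: "U \<in> carrier_mat d d" "mat_adjoint U * U = 1\<^sub>m d"
    and D: "mat_adjoint U * M * U = mat_diag d (\<lambda>i. complex_of_real (eigval M (Suc i)))"
    using dec(2) by blast
  define F where "F = mat d r (\<lambda>(i, j). U $$ (i, j))"
  have F: "F \<in> carrier_mat d r" by (simp add: F_def)
  have "mat_adjoint F * F = 1\<^sub>m r"
  proof (rule eq_matI)
    fix i j assume "i < dim_row (1\<^sub>m r :: complex mat)" "j < dim_col (1\<^sub>m r :: complex mat)"
    then have ij: "i < r" "j < r" by auto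
    have "(mat_adjoint F * F) $$ (i, j) = (mat_adjoint U * U) $$ (i, j)"
      using ij r U(1) by (auto simp: F_def scalar_prod_def intro!: sum.cong)
    then show "(mat_adjoint F * F) $$ (i, j) = 1\<^sub>m r $$ (i, j)"
      using ij r by (simp add: U(2))
  qed (use F in auto)
  moreover have "eigval M r * (vec_norm2 (F *\<^sub>v y))\<^sup>2 \<le> Re ((M *\<^sub>v (F *\<^sub>v y)) \<bullet>c (F *\<^sub>v y))"
    if y: "y \<in> carrier_vec r" for y
  proof -
    define y' where "y' = vec d (\<lambda>i. if i < r then y $ i else 0)"
    have y': "y' \<in> carrier_vec d" by (simp add: y'_def)
    have Fy: "F *\<^sub>v y = U *\<^sub>v y'"
    proof (rule eq_vecI)
      fix i assume "i < dim_vec (U *\<^sub>v y')"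
      then have i: "i < d" using U by simp
      have "(F *\<^sub>v y) $ i = (\<Sum>j\<in>{0..<r}. U $$ (i, j) * y $ j)"
        using i F y by (auto simp: F_def scalar_prod_def intro!: sum.cong)
      also have "\<dots> = (\<Sum>j\<in>{0..<d}. U $$ (i, j) * y' $ j)"
        using r by (intro sum.mono_neutral_cong_left) (auto simp: y'_def)
      also have "\<dots> = (U *\<^sub>v y') $ i"
        using i U y' by (auto simp: scalar_prod_def intro!: sum.cong)
      finally show "(F *\<^sub>v y) $ i = (U *\<^sub>v y') $ i" .
    qed (use F U in simp)
    have "eigval M r * (vec_norm2 (F *\<^sub>v y))\<^sup>2 = (\<Sum>i<d. eigval M r * (cmod (y' $ i))\<^sup>2)"
      using y' isometry_preserves_vec_norm2[OF U y']
      by (simp add: Fy sum_distrib_left vec_norm2_sq)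
    also have "\<dots> \<le> (\<Sum>i<d. eigval M (Suc i) * (cmod (y' $ i))\<^sup>2)"
    proof (rule sum_mono)
      fix i assume i: "i \<in> {..<d}"
      show "eigval M r * (cmod (y' $ i))\<^sup>2 \<le> eigval M (Suc i) * (cmod (y' $ i))\<^sup>2"
      proof (cases "i < r")
        case True
        then have "eigval M (Suc (r - 1)) \<le> eigval M (Suc i)"
          using r dec(1) by (intro eigval_antimono) auto
        then show ?thesis
          using r by (intro mult_right_mono) auto
      qed (use i in \<open>simp add: y'_def\<close>)
    qed
    also have "\<dots> = Re ((M *\<^sub>v (F *\<^sub>v y)) \<bullet>c (F *\<^sub>v y))"
      using quadratic_form_in_eigenbasis[OF M U(1) D y'] by (simp add: Fy)
    finally show ?thesis .
  qed
  ultimately show thesis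
    using that F by blast
qed

section \<open>The quadratic form of a bordered matrix\<close>

text \<open>
  The factor on the left is the smaller eigenvalue of the real symmetric matrix with diagonal
  \<open>c\<close>, \<open>l\<close> and off-diagonal entries \<open>- \<alpha>\<close>. Writing it as \<open>min c l - \<beta>\<close>, the number \<open>\<beta>\<close> is the
  nonnegative root of \<open>\<beta> (\<beta> + \<eta>) = \<alpha>\<^sup>2\<close>. Subtracting it from the diagonal leaves the entries \<open>\<beta>\<close>
  and \<open>\<beta> + \<eta>\<close>, in the order given by which of \<open>c\<close> and \<open>l\<close> is smaller; their product is \<open>\<alpha>\<^sup>2\<close>, so
  the remaining form is a perfect square.
\<close>

lemma min_eigenvalue_2x2:
  fixes c l \<alpha> \<eta> s p :: real
  assumes "\<eta> = \<bar>c - l\<bar>" and "0 \<le> \<alpha>" "0 \<le> s" "0 \<le> p"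
  shows "(min c l - 2 * \<alpha>\<^sup>2 / (\<eta> + sqrt (\<eta>\<^sup>2 + 4 * \<alpha>\<^sup>2))) * (s\<^sup>2 + p\<^sup>2)
    \<le> c * s\<^sup>2 - 2 * \<alpha> * s * p + l * p\<^sup>2"
proof -
  define w where "w = sqrt (\<eta>\<^sup>2 + 4 * \<alpha>\<^sup>2)"
  define \<beta> where "\<beta> = (w - \<eta>) / 2"
  have w2: "w\<^sup>2 = \<eta>\<^sup>2 + 4 * \<alpha>\<^sup>2" and w0: "0 \<le> w"
    by (auto simp: w_def)
  have e0: "0 \<le> \<eta>" using assms by simp
  have "\<eta> \<le> w" using e0 by (simp add: w_def real_le_rsqrt)
  then have b0: "0 \<le> \<beta>" by (simp add: \<beta>_def)
  have prod: "\<beta> * (\<beta> + \<eta>) = \<alpha>\<^sup>2"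
    using w2 by (simp add: \<beta>_def field_simps power2_eq_square)
  \<comment> \<open>Rationalising the fraction; in the degenerate case \<open>\<eta> = \<alpha> = 0\<close> division by zero gives the
    intended value \<open>0\<close>.\<close>
  have frac: "2 * \<alpha>\<^sup>2 / (\<eta> + w) = \<beta>"
  proof (cases "\<eta> + w = 0")
    case True
    then have "\<eta> = 0" "w = 0" using e0 w0 by auto
    then show ?thesis by (simp add: \<beta>_def)
  next
    case False
    have "2 * \<alpha>\<^sup>2 = \<beta> * (\<eta> + w)"
      using prod by (simp add: \<beta>_def field_simps)
    then show ?thesis using False by simp
  qed
  have key: "2 * \<alpha> * x * y \<le> \<beta> * x\<^sup>2 + (\<beta> + \<eta>) * y\<^sup>2" for x y :: real
  proof -
    have "\<alpha> = sqrt \<beta> * sqrt (\<beta> + \<eta>)"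
      using assms(2) prod by (metis real_sqrt_abs abs_of_nonneg real_sqrt_mult)
    moreover have "0 \<le> (sqrt \<beta> * x - sqrt (\<beta> + \<eta>) * y)\<^sup>2" by simp
    ultimately show ?thesis
      using b0 e0 by (simp add: power2_diff power_mult_distrib algebra_simps)
  qed
  show ?thesis
  proof (cases "c \<le> l")
    case True
    then have "l = c + \<eta>" using assms(1) by simp
    then show ?thesis
      using key[of s p] True e0 by (simp add: frac flip: w_def) (simp add: algebra_simps)
  next
    case False
    then have "c = l + \<eta>" using assms(1) by simp
    then show ?thesis
      using key[of p s] False e0 by (simp add: frac flip: w_def) (simp add: algebra_simps)
  qed
qed

lemma bordered_mat_carrier:
  "M \<in> carrier_mat d d \<Longrightarrow> a \<in> carrier_vec d \<Longrightarrow> bordered_mat c a M \<in> carrier_mat (1 + d) (1 + d)"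
  by (auto simp: bordered_mat_def Let_def)

lemma bordered_mat_hermitian:
  assumes M: "M \<in> carrier_mat d d" "mat_adjoint M = M" and a: "a \<in> carrier_vec d"
  shows "mat_adjoint (bordered_mat c a M) = bordered_mat c a M"
proof -
  have c: "mat_of_cols d [a] \<in> carrier_mat d 1" using mat_of_cols_carrier(1)[of d "[a]"] by simp
  have "mat_adjoint (mat 1 1 (\<lambda>_. complex_of_real c)) = mat 1 1 (\<lambda>_. complex_of_real c)"
    by (intro eq_matI) auto
  then show ?thesis
    using a mat_adjoint_four_block[of "mat 1 1 (\<lambda>_. complex_of_real c)" 1 1
        "mat_adjoint (mat_of_cols d [a])" d "mat_of_cols d [a]" d M] M c
    by (simp add: bordered_mat_def Let_def)
qed

lemma bordered_mat_quadratic_form: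
  assumes M: "M \<in> carrier_mat d d" and a: "a \<in> carrier_vec d" and u: "u \<in> carrier_vec d"
  shows "Re ((bordered_mat c a M *\<^sub>v (vec 1 (\<lambda>_. t) @\<^sub>v u)) \<bullet>c (vec 1 (\<lambda>_. t) @\<^sub>v u)) =
    c * (cmod t)\<^sup>2 + 2 * Re (t * (a \<bullet>c u)) + Re ((M *\<^sub>v u) \<bullet>c u)"
proof -
  let ?C = "mat_of_cols d [a]" and ?t = "vec 1 (\<lambda>_. t)"
  let ?c = "mat 1 1 (\<lambda>_. complex_of_real c)"
  have C: "?C \<in> carrier_mat d 1" using mat_of_cols_carrier(1)[of d "[a]"] by simp
  have C': "mat_adjoint ?C \<in> carrier_mat 1 d" using C by simp
  have t: "?t \<in> carrier_vec 1" by simp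
  have "bordered_mat c a M *\<^sub>v (?t @\<^sub>v u) =
    (?c *\<^sub>v ?t + mat_adjoint ?C *\<^sub>v u) @\<^sub>v (?C *\<^sub>v ?t + M *\<^sub>v u)"
    using four_block_mat_mult_vec[OF _ C' C M t u, of ?c] a by (simp add: bordered_mat_def Let_def)
  also have "?c *\<^sub>v ?t + mat_adjoint ?C *\<^sub>v u = vec 1 (\<lambda>_. complex_of_real c * t + cnj (a \<bullet>c u))"
    using C a u by (intro eq_vecI) (auto simp: scalar_prod_def mat_of_cols_index mult.commute intro!: sum.cong)
  also have "?C *\<^sub>v ?t = t \<cdot>\<^sub>v a"
    using C a by (intro eq_vecI) (auto simp: scalar_prod_def mat_of_cols_index)
  finally have Ax: "bordered_mat c a M *\<^sub>v (?t @\<^sub>v u) =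
    vec 1 (\<lambda>_. complex_of_real c * t + cnj (a \<bullet>c u)) @\<^sub>v (t \<cdot>\<^sub>v a + M *\<^sub>v u)" .
  have conj: "conjugate (?t @\<^sub>v u) = vec 1 (\<lambda>_. cnj t) @\<^sub>v conjugate u"
    by (intro eq_vecI) auto
  have Mu: "M *\<^sub>v u \<in> carrier_vec d" using M u by simp
  have u': "conjugate u \<in> carrier_vec d" using u by simp
  have ta: "t \<cdot>\<^sub>v a \<in> carrier_vec d" using a by simp
  have "(bordered_mat c a M *\<^sub>v (?t @\<^sub>v u)) \<bullet>c (?t @\<^sub>v u) =
      (complex_of_real c * t + cnj (a \<bullet>c u)) * cnj t + (t \<cdot>\<^sub>v a + M *\<^sub>v u) \<bullet>c u"
    unfolding Ax conj using ta Mu u'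
    by (subst scalar_prod_append[of _ 1 _ d]) (auto simp: scalar_prod_def)
  also have "(t \<cdot>\<^sub>v a + M *\<^sub>v u) \<bullet>c u = t * (a \<bullet>c u) + (M *\<^sub>v u) \<bullet>c u"
    using add_scalar_prod_distrib[OF ta Mu u'] a u' by simp
  also have "(complex_of_real c * t + cnj (a \<bullet>c u)) * cnj t =
      complex_of_real (c * (cmod t)\<^sup>2) + cnj (t * (a \<bullet>c u))"
    by (simp add: complex_norm_square algebra_simps del: of_real_power)
  finally show ?thesis
    by simp
qed

lemma vec_norm2_append_sq:
  "(vec_norm2 (vec 1 (\<lambda>_. t) @\<^sub>v u))\<^sup>2 = (cmod t)\<^sup>2 + (vec_norm2 u)\<^sup>2"
  by (simp add: vec_norm2_sq lessThan_Suc_eq_insert_0 sum.insert sum.reindex)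

text \<open>
  By Cauchy--Schwarz, the cross term \<open>2 Re (t (u\<^sup>* a))\<close> is at least \<open>- 2 |t| \<parallel>a\<parallel> \<parallel>u\<parallel>\<close>. So the form is
  bounded below by a real quadratic form in the two numbers \<open>|t|\<close> and \<open>\<parallel>u\<parallel>\<close>, whose smallest
  eigenvalue has been computed above.
\<close>

lemma bordered_mat_quadratic_form_bound:
  fixes t :: complex
  assumes M: "M \<in> carrier_mat d d" and a: "a \<in> carrier_vec d" and u: "u \<in> carrier_vec d"
    and lu: "l * (vec_norm2 u)\<^sup>2 \<le> Re ((M *\<^sub>v u) \<bullet>c u)" and \<eta>: "\<eta> = \<bar>c - l\<bar>"
  defines "x \<equiv> vec 1 (\<lambda>_. t) @\<^sub>v u"
  shows "(min c l - 2 * (vec_norm2 a)\<^sup>2 / (\<eta> + sqrt (\<eta>\<^sup>2 + 4 * (vec_norm2 a)\<^sup>2))) * (vec_norm2 x)\<^sup>2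
    \<le> Re ((bordered_mat c a M *\<^sub>v x) \<bullet>c x)"
proof -
  have "cmod (t * (a \<bullet>c u)) \<le> cmod t * (vec_norm2 a * vec_norm2 u)"
    using cscalar_prod_Cauchy_Schwarz[of a u] a u by (simp add: norm_mult mult_left_mono)
  then have "- Re (t * (a \<bullet>c u)) \<le> vec_norm2 a * cmod t * vec_norm2 u"
    using abs_Re_le_cmod[of "t * (a \<bullet>c u)"] by (simp add: mult_ac)
  then show ?thesis
    using min_eigenvalue_2x2[OF \<eta>, of "vec_norm2 a" "cmod t" "vec_norm2 u"] lu
    unfolding x_def bordered_mat_quadratic_form[OF M a u] vec_norm2_append_sq by simp
qed

section \<open>The eigenvalue bound\<close>

theorem theorem3p4:
  fixes d r :: nat and M A :: "complex mat" and a :: "complex vec" and c \<eta> :: real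
  assumes "d \<ge> 1"
    and "M \<in> carrier_mat d d"
    and "psd_mat M"
    and "a \<in> carrier_vec d"
    and "A = bordered_mat c a M"
    and "vec_space.rank d M = r"
    and "1 \<le> r" and "r \<le> d"
    and "\<eta> = \<bar>c - eigval M r\<bar>"
  shows "eigval A (r + 1) \<ge> min c (eigval M r)
           - 2 * (vec_norm2 a)\<^sup>2 / (\<eta> + sqrt (\<eta>\<^sup>2 + 4 * (vec_norm2 a)\<^sup>2))"
proof -
  note M = assms(2) and a = assms(4)
  have h: "mat_adjoint M = M"
    using assms(3) by (simp add: psd_mat_def hermitian_mat_def)
  obtain F where F: "F \<in> carrier_mat d r" "mat_adjoint F * F = 1\<^sub>m r"
    and lb: "\<And>y. y \<in> carrier_vec r \<Longrightarrow>
      eigval M r * (vec_norm2 (F *\<^sub>v y))\<^sup>2 \<le> Re ((M *\<^sub>v (F *\<^sub>v y)) \<bullet>c (F *\<^sub>v y))"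
    using top_eigenvectors_isometry[OF M h assms(7,8)] by blast
  \<comment> \<open>The \<open>r + 1\<close> columns of this matrix are the first unit vector and the top \<open>r\<close> eigenvectors of
    \<open>M\<close>, extended by a leading zero.\<close>
  let ?F = "four_block_mat (1\<^sub>m 1) (0\<^sub>m 1 r) (0\<^sub>m d 1) F"
  have F': "?F \<in> carrier_mat (1 + d) (1 + r)" using F by auto
  have Fz: "?F *\<^sub>v z = vec 1 (\<lambda>_. z $ 0) @\<^sub>v (F *\<^sub>v vec_last z r)"
    if z: "z \<in> carrier_vec (1 + r)" for z
  proof -
    have "vec_first z 1 = vec 1 (\<lambda>_. z $ 0)"
      using z by (intro eq_vecI) (auto simp: vec_first_def)
    then have "?F *\<^sub>v z = ?F *\<^sub>v (vec 1 (\<lambda>_. z $ 0) @\<^sub>v vec_last z r)"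
      using vec_first_last_append[OF z] by simp
    also have "\<dots> = vec 1 (\<lambda>_. z $ 0) @\<^sub>v (F *\<^sub>v vec_last z r)"
      using F by (subst four_block_mat_mult_vec[of _ 1 1 _ r _ d]) auto
    finally show ?thesis .
  qed
  have "min c (eigval M r) - 2 * (vec_norm2 a)\<^sup>2 / (\<eta> + sqrt (\<eta>\<^sup>2 + 4 * (vec_norm2 a)\<^sup>2))
      \<le> eigval A (1 + r)"
  proof (rule eigval_lower_bound_on_subspace[OF _ _ F'])
    show "A \<in> carrier_mat (1 + d) (1 + d)" "mat_adjoint A = A"
      using bordered_mat_carrier[OF M a] bordered_mat_hermitian[OF M h a] assms(5) by auto
  next
    fix z :: "complex vec" assume z: "z \<in> carrier_vec (1 + r)" and 0: "?F *\<^sub>v z = 0\<^sub>v (1 + d)"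
    have adj: "mat_adjoint ?F = four_block_mat (1\<^sub>m 1) (0\<^sub>m 1 d) (0\<^sub>m r 1) (mat_adjoint F)"
      using F by (subst mat_adjoint_four_block[of _ 1 1 _ r _ d]) auto
    have "mat_adjoint ?F * ?F = 1\<^sub>m (1 + r)"
      unfolding adj using F by (subst mult_block_diag) auto
    then have "vec_norm2 z = vec_norm2 (?F *\<^sub>v z)"
      using isometry_preserves_vec_norm2[OF F' _ z] by simp
    also have "\<dots> = 0"
      unfolding 0 using vec_norm2_eq_0_iff[OF zero_carrier_vec, of "1 + d"] by simp
    finally show "z = 0\<^sub>v (1 + r)"
      using vec_norm2_eq_0_iff[OF z] by simp
  next
    fix z :: "complex vec" assume z: "z \<in> carrier_vec (1 + r)"
    show "(min c (eigval M r) - 2 * (vec_norm2 a)\<^sup>2 / (\<eta> + sqrt (\<eta>\<^sup>2 + 4 * (vec_norm2 a)\<^sup>2)))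
        * (vec_norm2 (?F *\<^sub>v z))\<^sup>2 \<le> Re ((A *\<^sub>v (?F *\<^sub>v z)) \<bullet>c (?F *\<^sub>v z))"
      unfolding Fz[OF z] assms(5)
      using F lb by (intro bordered_mat_quadratic_form_bound[OF M a _ _ assms(9)]) auto
  qed (use assms in auto)
  then show ?thesis by simp
qed

end
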